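(* If $Y$ is a generalized truncation of a multigraph $X$, then $\kappa'(Y)\leq\kappa'(X)$.
   Context: A multigraph may have multiple edges but no loops; it is assumed to have no isolated vertices. Generalized truncation of $X$: take a matching $M_0$ with $|M_0|=|E(X)|$ (on $2|E(X)|$ new vertices) and a bijection $F:E(X)\to M_0$; for each edge $e$ of $X$ with ends $u,v$, label one end of $F(e)$ by $u$ and the other by $v$. For $v\in V(X)$, the cluster $\mathrm{cl}(v)$ is the set of vertices labelled $v$; insert an arbitrary graph $\mathrm{con}(v)$ on $\mathrm{cl}(v)$. The graph $F(M_0)\cup\bigcup_v\mathrm{con}(v)$ (or any graph isomorphic to it) is a generalized truncation of $X$. $\kappa'$ denotes edge connectivity: the minimum number of edges whose deletion disconnects the multigraph (equal to $0$ if it is disconnected). *)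

theory Defs
  imports Main "HOL-Library.Extended_Nat"
begin

record ('v, 'e) multigraph =
  verts :: "'v set"
  edges :: "'e set"
  ends :: "'e \<Rightarrow> 'v set"

text \<open>Parallel edges are allowed; finiteness is not required.\<close>

definition is_multigraph :: "('v, 'e) multigraph \<Rightarrow> bool" where
  "is_multigraph X \<longleftrightarrow>
     (\<forall>e\<in>edges X. ends X e \<subseteq> verts X \<and> card (ends X e) = 2) \<and>
     (\<forall>v\<in>verts X. \<exists>e\<in>edges X. v \<in> ends X e)"

definition adjacent :: "('v, 'e) multigraph \<Rightarrow> 'v \<Rightarrow> 'v \<Rightarrow> bool" where
  "adjacent X u v \<longleftrightarrow> (\<exists>e\<in>edges X. ends X e = {u, v})"

definition multigraph_connected :: "('v, 'e) multigraph \<Rightarrow> bool" where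
  "multigraph_connected X \<longleftrightarrow>
     verts X \<noteq> {} \<and> (\<forall>u\<in>verts X. \<forall>v\<in>verts X. (adjacent X)\<^sup>*\<^sup>* u v)"

definition delete_edges :: "('v, 'e) multigraph \<Rightarrow> 'e set \<Rightarrow> ('v, 'e) multigraph" where
  "delete_edges X S = X\<lparr>edges := edges X - S\<rparr>"

text \<open>The infimum in \<^typ>\<open>enat\<close> is a minimum whenever some finite set of edges disconnects
  the multigraph, hence for every finite multigraph with at least two vertices; it is
  \<open>\<infinity>\<close> if there is no such set.\<close>

definition edge_connectivity :: "('v, 'e) multigraph \<Rightarrow> enat" where
  "edge_connectivity X =
     (INF S \<in> {S. S \<subseteq> edges X \<and> finite S \<and> \<not> multigraph_connected (delete_edges X S)}.
        enat (card S))"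

lemma edge_connectivity_disconnected:
  assumes "\<not> multigraph_connected X"
  shows "edge_connectivity X = 0"
proof -
  have "edge_connectivity X \<le> enat (card ({} :: 'b set))"
    unfolding edge_connectivity_def
    using assms by (intro INF_lower) (simp add: delete_edges_def)
  then show ?thesis
    by (simp add: zero_enat_def[symmetric])
qed

definition multigraph_iso :: "('v, 'e) multigraph \<Rightarrow> ('w, 'f) multigraph \<Rightarrow> bool" where
  "multigraph_iso X Y \<longleftrightarrow>
     (\<exists>f g. bij_betw f (verts X) (verts Y) \<and> bij_betw g (edges X) (edges Y) \<and>
        (\<forall>e\<in>edges X. ends Y (g e) = f ` ends X e))"

definition is_matching :: "'w set set \<Rightarrow> bool" where
  "is_matching M \<longleftrightarrow> (\<forall>m\<in>M. card m = 2) \<and> pairwise disjnt M"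

definition cluster :: "'w set set \<Rightarrow> ('w \<Rightarrow> 'v) \<Rightarrow> 'v \<Rightarrow> 'w set" where
  "cluster M lab v = {w \<in> \<Union>M. lab w = v}"

text \<open>\<open>lab\<close> labels the ends of the matching edges: it maps the two ends of \<open>F e\<close>
  bijectively onto the two ends of \<open>e\<close>. \<open>con v\<close> is the edge set of the (simple) graph
  inserted on the cluster of \<open>v\<close>.\<close>

definition truncation_data ::
  "('v, 'e) multigraph \<Rightarrow> 'w set set \<Rightarrow> ('e \<Rightarrow> 'w set) \<Rightarrow> ('w \<Rightarrow> 'v) \<Rightarrow> ('v \<Rightarrow> 'w set set) \<Rightarrow> bool"
where
  "truncation_data X M F lab con \<longleftrightarrow>
     is_matching M \<and>
     bij_betw F (edges X) M \<and>
     (\<forall>e\<in>edges X. bij_betw lab (F e) (ends X e)) \<and>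
     (\<forall>v\<in>verts X. \<forall>c\<in>con v. c \<subseteq> cluster M lab v \<and> card c = 2)"

definition truncation_graph ::
  "('v, 'e) multigraph \<Rightarrow> 'w set set \<Rightarrow> ('v \<Rightarrow> 'w set set) \<Rightarrow> ('w, 'w set) multigraph" where
  "truncation_graph X M con =
     \<lparr>verts = \<Union>M, edges = M \<union> (\<Union>v\<in>verts X. con v), ends = (\<lambda>c. c)\<rparr>"

text \<open>Taking the new vertices in the vertex type of \<open>Y\<close> loses nothing: a truncation over any
  other type that is isomorphic to \<open>Y\<close> can be transported along the isomorphism.\<close>

definition generalized_truncation ::
  "('v, 'e) multigraph \<Rightarrow> ('w, 'f) multigraph \<Rightarrow> bool" where
  "generalized_truncation X Y \<longleftrightarrow>
     (\<exists>(M :: 'w set set) F lab con.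
        truncation_data X M F lab con \<and> multigraph_iso (truncation_graph X M con) Y)"

end

theory Submission imports Defs begin

text \<open>Let \<open>S\<close> be a disconnecting edge set of \<open>X\<close>. Contracting every cluster maps the truncation
  onto \<open>X\<close>, and the matching edges outside \<open>F ` S\<close> onto the edges of \<open>X\<close> outside \<open>S\<close>. Hence
  a connected truncation minus \<open>F ` S\<close> would make \<open>X\<close> minus \<open>S\<close> connected, so that \<open>F ` S\<close>
  is a disconnecting set of at most the same size.\<close>

text \<open>A path in \<open>Y\<close> is mapped by \<open>p\<close> step by step, and the images
  are concatenated. The hypothesis on adjacent vertices asks for a path rather than an edge because
  an edge inside a fibre of \<open>p\<close> collapses to a single vertex.\<close>

lemma multigraph_connected_contract:
  assumes "multigraph_connected Y"
    and surj: "verts X \<subseteq> p ` verts Y" and "verts X \<noteq> {}"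
    and adj: "\<And>y y'. adjacent Y y y' \<Longrightarrow> (adjacent X)\<^sup>*\<^sup>* (p y) (p y')"
  shows "multigraph_connected X"
proof -
  have path: "(adjacent X)\<^sup>*\<^sup>* (p y) (p y')" if "(adjacent Y)\<^sup>*\<^sup>* y y'" for y y'
    using that
  proof induction
    case (step a b)
    then show ?case using adj by (meson rtranclp_trans)
  qed simp
  have "(adjacent X)\<^sup>*\<^sup>* u v" if uv: "u \<in> verts X" "v \<in> verts X" for u v
  proof -
    obtain a b where "a \<in> verts Y" "u = p a" "b \<in> verts Y" "v = p b"
      using uv surj by blast
    then show ?thesis
      using path \<open>multigraph_connected Y\<close> unfolding multigraph_connected_def by blast
  qed
  then show ?thesis
    using \<open>verts X \<noteq> {}\<close> unfolding multigraph_connected_def by blast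
qed

text \<open>The isomorphism \<open>f\<close>, \<open>g\<close> is built into the statement, so the
  contraction argument runs directly on \<open>Y\<close> and no separate transfer of connectivity
  from the truncation is required.\<close>

lemma truncation_disconnecting_set:
  assumes X: "is_multigraph X"
    and data: "truncation_data X M F lab con"
    and f: "bij_betw f (verts (truncation_graph X M con)) (verts Y)"
    and g: "bij_betw g (edges (truncation_graph X M con)) (edges Y)"
    and ends: "\<forall>c\<in>edges (truncation_graph X M con). ends Y (g c) = f ` c"
    and disc: "\<not> multigraph_connected (delete_edges X S)"
  shows "\<not> multigraph_connected (delete_edges Y (g ` F ` S))"
proof
  assume conn: "multigraph_connected (delete_edges Y (g ` F ` S))"
  \<comment> \<open>This is the contraction of the clusters, read on \<open>Y\<close>: go back along
    \<open>f\<close> to the truncation, then take the label.\<close>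
  define p where "p = lab \<circ> inv_into (\<Union>M) f"
  have F: "F ` edges X = M"
    and lab: "\<And>e. e \<in> edges X \<Longrightarrow> lab ` F e = ends X e"
    and con: "\<And>v c. v \<in> verts X \<Longrightarrow> c \<in> con v \<Longrightarrow> c \<subseteq> cluster M lab v"
    using data unfolding truncation_data_def bij_betw_def by auto
  have f': "bij_betw f (\<Union>M) (verts Y)"
    using f by (simp add: truncation_graph_def)
  have g': "g ` (M \<union> (\<Union>v\<in>verts X. con v)) = edges Y"
    and ends': "\<And>c. c \<in> M \<union> (\<Union>v\<in>verts X. con v) \<Longrightarrow> ends Y (g c) = f ` c"
    using g ends unfolding bij_betw_def by (simp_all add: truncation_graph_def)
  have p_f: "p (f w) = lab w" if "w \<in> \<Union>M" for w
    using f' that unfolding p_def bij_betw_def by (simp add: inv_into_f_f)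
  \<comment> \<open>A multigraph without vertices counts as disconnected, so this case has to be
    excluded. Connectedness gives \<open>Y\<close> a vertex, which comes from an end of a matching
    edge, hence from an edge of \<open>X\<close>.\<close>
  have "verts X \<noteq> {}"
  proof -
    have "verts Y \<noteq> {}"
      using conn unfolding multigraph_connected_def delete_edges_def by simp
    then have "\<Union>M \<noteq> {}"
      using f' unfolding bij_betw_def by (metis image_empty)
    then obtain e where "e \<in> edges X"
      using F by auto
    then have "ends X e \<subseteq> verts X" "card (ends X e) = 2"
      using X unfolding is_multigraph_def by blast+
    then show ?thesis by auto
  qed
  \<comment> \<open>Here the absence of isolated vertices enters: it makes every cluster
    nonempty.\<close>
  moreover have "verts X \<subseteq> p ` verts Y"
  proof
    fix v assume "v \<in> verts X"
    then obtain e where e: "e \<in> edges X" "v \<in> ends X e"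
      using X unfolding is_multigraph_def by blast
    then have "v \<in> lab ` F e"
      using lab by simp
    then obtain w where w: "w \<in> F e" "lab w = v"
      by blast
    moreover have "w \<in> \<Union>M"
      using e(1) w(1) unfolding F[symmetric] by blast
    ultimately have "v = p (f w)" "f w \<in> verts Y"
      using p_f f' unfolding bij_betw_def by auto
    then show "v \<in> p ` verts Y" by blast
  qed
  moreover have "(adjacent (delete_edges X S))\<^sup>*\<^sup>* (p y) (p y')"
    if adj: "adjacent (delete_edges Y (g ` F ` S)) y y'" for y y'
  proof -
    obtain d where d: "d \<in> edges Y" "d \<notin> g ` F ` S" "ends Y d = {y, y'}"
      using adj unfolding adjacent_def delete_edges_def by auto
    obtain c where c: "c \<in> M \<union> (\<Union>v\<in>verts X. con v)" "d = g c"
      using d(1) unfolding g'[symmetric] by (elim imageE)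
    have "c \<subseteq> \<Union>M"
      using c(1) by (auto dest!: con simp: cluster_def)
    then have "p ` f ` c = lab ` c"
      unfolding image_image by (intro image_cong refl p_f) blast
    moreover have "f ` c = {y, y'}"
      using c d ends' by simp
    \<comment> \<open>The labels on \<open>c\<close> determine the image of the edge
      \<open>d\<close> under \<open>p\<close>: two adjacent vertices if \<open>c\<close> is a
      matching edge, a single vertex if \<open>c\<close> was inserted in a cluster.\<close>
    ultimately have labc: "lab ` c = {p y, p y'}" by auto
    show ?thesis
      using c(1)
    proof
      assume "c \<in> M"
      then obtain e where e: "e \<in> edges X" "F e = c"
        using F by blast
      \<comment> \<open>Otherwise \<open>d = g (F e)\<close> would be one of the deleted
        edges.\<close>
      then have "e \<notin> S" using c d by blast
      moreover have "ends X e = {p y, p y'}"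
        using lab[of e] e labc by simp
      ultimately have "adjacent (delete_edges X S) (p y) (p y')"
        using e(1) unfolding adjacent_def delete_edges_def by simp blast
      then show ?thesis by blast
    next
      assume "c \<in> (\<Union>v\<in>verts X. con v)"
      then obtain v where "v \<in> verts X" "c \<in> con v" by blast
      then have "lab ` c \<subseteq> {v}"
        using con[of v c] unfolding cluster_def by auto
      then have "p y = p y'" using labc by auto
      then show ?thesis by simp
    qed
  qed
  ultimately have "multigraph_connected (delete_edges X S)"
    using conn by (intro multigraph_connected_contract[of "delete_edges Y (g ` F ` S)" _ p])
      (simp_all add: delete_edges_def)
  with disc show False ..
qed

theorem theorem3p2:
  fixes X :: "('v, 'e) multigraph" and Y :: "('w, 'f) multigraph"
  assumes "is_multigraph X"
    and "generalized_truncation X Y"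
  shows "edge_connectivity Y \<le> edge_connectivity X"
proof -
  obtain M :: "'w set set" and F lab con where
    data: "truncation_data X M F lab con" and "multigraph_iso (truncation_graph X M con) Y"
    using assms(2) unfolding generalized_truncation_def by (elim exE conjE)
  then obtain f g where
    f: "bij_betw f (verts (truncation_graph X M con)) (verts Y)"
    and g: "bij_betw g (edges (truncation_graph X M con)) (edges Y)"
    and "\<forall>c\<in>edges (truncation_graph X M con).
      ends Y (g c) = f ` ends (truncation_graph X M con) c"
    unfolding multigraph_iso_def by (elim exE conjE)
  then have ends: "\<forall>c\<in>edges (truncation_graph X M con). ends Y (g c) = f ` c"
    by (simp add: truncation_graph_def)
  show ?thesis
    unfolding edge_connectivity_def
  \<comment> \<open>Each disconnecting set of \<open>X\<close> is matched with one of
    \<open>Y\<close> that is no larger. This also covers an \<open>X\<close> without finite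
    disconnecting sets, where the right-hand side is infinite.\<close>
  proof (rule INF_mono)
    fix S assume "S \<in> {S. S \<subseteq> edges X \<and> finite S \<and> \<not> multigraph_connected (delete_edges X S)}"
    then have S: "S \<subseteq> edges X" "finite S" "\<not> multigraph_connected (delete_edges X S)"
      by auto
    have "F ` S \<subseteq> edges (truncation_graph X M con)"
      using S(1) data unfolding truncation_data_def truncation_graph_def bij_betw_def by auto
    then have "g ` F ` S \<subseteq> edges Y"
      using g unfolding bij_betw_def by blast
    moreover have "card (g ` F ` S) \<le> card S"
      using S(2) by (metis card_image_le image_image)
    ultimately show "\<exists>T\<in>{T. T \<subseteq> edges Y \<and> finite T \<and> \<not> multigraph_connected (delete_edges Y T)}.
        enat (card T) \<le> enat (card S)"
      using S(2) truncation_disconnecting_set[OF assms(1) data f g ends S(3)]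
      by (intro bexI[of _ "g ` F ` S"]) auto
  qed
qed

end
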